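(* Suppose that $n\geq 2k+2$ and $k\geq 1$. Let $\mathcal{L}$ be a Cameron-Liebler $k$-set of parameter $x$ in $\mathrm{AG}(n,q)$ such that $\mathcal{L}$ is not a point-pencil, nor the empty set. Then $$x\geq 2\left(\frac{q^{n-k}-1}{q^{k+1}-1}\right)+1.$$
   Context: A Cameron-Liebler $k$-set in $\mathrm{AG}(n,q)$ is a set $\mathcal{L}$ of $k$-spaces of $\mathrm{AG}(n,q)$ whose characteristic vector lies in the row space of the point-($k$-space) incidence matrix of $\mathrm{AG}(n,q)$ (equivalently, $\mathcal{L}$ meets every $k$-spread of $\mathrm{AG}(n,q)$ in a constant number $x$ of elements); it has parameter $x$ if $|\mathcal{L}|=x\begin{bmatrix} n \\ k\end{bmatrix}_q$, where $\begin{bmatrix} b \\ a\end{bmatrix}_q=\frac{(q^b-1)\cdots(q^{b-a+1}-1)}{(q^a-1)\cdots(q-1)}$ is the Gaussian binomial coefficient. A point-pencil is the set of all $k$-spaces through a fixed point. *)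

theory Defs
  imports "HOL-Analysis.Analysis"
begin

text \<open>
  The points of AG(\<open>n\<close>, \<open>q\<close>) are the vectors of type \<open>'a ^ 'n\<close>, where \<open>'a\<close> is a finite
  field, \<open>q = CARD('a)\<close> and \<open>n = CARD('n)\<close>. A \<open>k\<close>-space is identified with the set of its points.
\<close>

definition k_spaces :: "nat \<Rightarrow> ('a::{field,finite} ^ 'n) set set" where
  "k_spaces k = {(+) p ` U | p U. vec.subspace U \<and> vec.dim U = k}"

definition point_pencil :: "nat \<Rightarrow> 'a::{field,finite} ^ 'n \<Rightarrow> ('a ^ 'n) set set" where
  "point_pencil k p = {K \<in> k_spaces k. p \<in> K}"

text \<open>
  The set of \<open>k\<close>-spaces is not a type, so the columns are indexed by all sets of points. Columns
  that do not belong to a \<open>k\<close>-space are zero, as are the corresponding entries of the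
  characteristic vector of a set of \<open>k\<close>-spaces, so this padding does not affect membership in
  the row space.
\<close>

definition incidence_matrix :: "nat \<Rightarrow> real ^ (('a::{field,finite} ^ 'n) set) ^ ('a ^ 'n)" where
  "incidence_matrix k = (\<chi> p K. if K \<in> k_spaces k \<and> p \<in> K then 1 else 0)"

definition char_vec :: "('a::{field,finite} ^ 'n) set set \<Rightarrow> real ^ (('a ^ 'n) set)" where
  "char_vec L = (\<chi> K. if K \<in> L then 1 else 0)"

definition cameron_liebler :: "nat \<Rightarrow> ('a::{field,finite} ^ 'n) set set \<Rightarrow> bool" where
  "cameron_liebler k L \<longleftrightarrow>
     L \<subseteq> k_spaces k \<and> char_vec L \<in> span (rows (incidence_matrix k))"

text \<open>Intended for \<open>a \<le> b\<close> and \<open>q > 1\<close>; the exponent \<open>b - i\<close> is truncated otherwise.\<close>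

definition gauss_binomial :: "nat \<Rightarrow> nat \<Rightarrow> nat \<Rightarrow> real" where
  "gauss_binomial q b a = (\<Prod>i<a. (real q ^ (b - i) - 1)) / (\<Prod>i<a. (real q ^ (a - i) - 1))"

definition has_parameter :: "nat \<Rightarrow> ('a::{field,finite} ^ 'n) set set \<Rightarrow> real \<Rightarrow> bool" where
  "has_parameter k L x \<longleftrightarrow> real (card L) = x * gauss_binomial CARD('a) CARD('n) k"

end

theory Submission
  imports Defs
begin

text \<open>
  Membership in the row space gives a real weight \<open>w\<close> on the points such that every \<open>k\<close>-space has
  total weight 0 or 1, and double counting shows that the whole space has weight \<open>x\<close>. If \<open>x\<close> is
  below the bound, then \<open>x < (q^(n-k) - 1) / (q - 1)\<close>, and under this weaker hypothesis the property
  of having weights in \<open>{0, 1}\<close> descends from flats of dimension \<open>j + 1\<close> to flats of dimension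
  \<open>j < k\<close>, hence down to points. Two points of weight 1 would lie on a flat of weight at least 2,
  so \<open>w\<close> vanishes or is the indicator of a point, and the set is empty or a point-pencil.
\<close>

section \<open>Cardinality of subspaces over a finite field\<close>

lemma card_field_gt_1: "CARD('a::{field,finite}) > 1"
proof -
  have "card {0, 1::'a} \<le> CARD('a)" by (rule card_mono) auto
  then show ?thesis by simp
qed

text \<open>Each new basis vector multiplies the size by the order of the field: the map taking
  \<open>(c, u)\<close> to \<open>c *s b + u\<close> is a bijection from the scalars times the old
  span onto the new one.\<close>

lemma card_span_independent:
  fixes B :: "('a::{field,finite} ^ 'n) set"
  assumes "finite B" "vec.independent B"
  shows "card (vec.span B) = CARD('a) ^ card B"
  using assms
proof (induction B)
  case empty
  then show ?case by simp
next
  case (insert b B)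
  then have ind: "vec.independent B" and nb: "b \<notin> vec.span B"
    by (auto simp: vec.independent_insert)
  let ?f = "\<lambda>(c::'a, u). c *s b + u"
  have eq: "vec.span (insert b B) = ?f ` (UNIV \<times> vec.span B)"
  proof (intro set_eqI iffI)
    fix x assume "x \<in> vec.span (insert b B)"
    then obtain k where "x - k *s b \<in> vec.span B" unfolding vec.span_insert by blast
    then show "x \<in> ?f ` (UNIV \<times> vec.span B)"
      by (intro image_eqI[where x = "(k, x - k *s b)"]) auto
  next
    fix x assume "x \<in> ?f ` (UNIV \<times> vec.span B)"
    then obtain k u where "x = k *s b + u" "u \<in> vec.span B" by auto
    then show "x \<in> vec.span (insert b B)" unfolding vec.span_insert
      by (auto intro!: exI[of _ k])
  qed
  have inj: "inj_on ?f (UNIV \<times> vec.span B)"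
  proof (rule inj_onI, clarsimp)
    fix c d :: 'a and u v
    assume u: "u \<in> vec.span B" and v: "v \<in> vec.span B" and e: "c *s b + u = d *s b + v"
    have "c = d"
    proof (rule ccontr)
      assume ne: "c \<noteq> d"
      have "(c - d) *s b = v - u"
        using e by (simp add: vec.scale_left_diff_distrib algebra_simps)
      then have "inverse (c - d) *s ((c - d) *s b) \<in> vec.span B"
        using u v by (simp only: vec.span_diff vec.span_scale)
      moreover have "inverse (c - d) *s ((c - d) *s b) = b"
        unfolding vec.scale_scale using ne by simp
      ultimately show False using nb by simp
    qed
    then show "c = d \<and> u = v" using e by simp
  qed
  show ?case using insert ind unfolding eq card_image[OF inj]
    by (simp add: card_cartesian_product)
qed

lemma card_subspace:
  fixes U :: "('a::{field,finite} ^ 'n) set"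
  assumes "vec.subspace U"
  shows "card U = CARD('a) ^ vec.dim U"
proof -
  obtain B where B: "finite B" "vec.independent B" "vec.span B = U" "card B = vec.dim U"
    by (rule vec.basis_subspace_exists[OF assms])
  then show ?thesis using card_span_independent[OF B(1,2)] by simp
qed

lemma card_subspace_diff:
  fixes U S :: "('a::{field,finite} ^ 'n) set"
  assumes "vec.subspace U" "vec.subspace S" "U \<subseteq> S"
  shows "real (card (S - U)) = real CARD('a) ^ vec.dim S - real CARD('a) ^ vec.dim U"
proof -
  have "card U \<le> card S" using assms by (intro card_mono) auto
  then show ?thesis using assms
    by (simp add: card_Diff_subset card_subspace of_nat_diff del: of_nat_power flip: of_nat_power)
qed

lemma subspace_eq_span:
  fixes S :: "('a::field ^ 'n) set"
  assumes "vec.subspace S" "A \<subseteq> S" "vec.dim A = vec.dim S"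
  shows "S = vec.span A"
proof -
  have "vec.span A = vec.span S" using assms by (intro vec.dim_eq_span) auto
  then show ?thesis using assms(1) vec.span_eq_iff by metis
qed

section \<open>Counting subspaces by Gaussian binomials\<close>

text \<open>These are the ordered linearly independent \<open>k\<close>-tuples of \<open>S\<close>.
  Choosing each vector outside the span of the earlier ones turns their number into a
  product.\<close>

fun indep_lists :: "('a::field ^ 'n) set \<Rightarrow> nat \<Rightarrow> ('a ^ 'n) list set" where
  "indep_lists S 0 = {[]}"
| "indep_lists S (Suc k) =
    (\<lambda>(vs, v). v # vs) ` (SIGMA vs:indep_lists S k. S - vec.span (set vs))"

lemma indep_lists_dim: "vs \<in> indep_lists S k \<Longrightarrow> vec.dim (set vs) = k"
  by (induction k arbitrary: vs) (auto simp: vec.dim_insert)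

lemma indep_lists_subset: "vs \<in> indep_lists S k \<Longrightarrow> set vs \<subseteq> S"
  by (induction k arbitrary: vs) force+

lemma indep_lists_mono: "vs \<in> indep_lists S k \<Longrightarrow> set vs \<subseteq> T \<Longrightarrow> vs \<in> indep_lists T k"
proof (induction k arbitrary: vs)
  case 0
  then show ?case by simp
next
  case (Suc k)
  then obtain v us where "vs = v # us" "us \<in> indep_lists S k" "v \<notin> vec.span (set us)" by auto
  then show ?case using Suc by (auto intro!: image_eqI[where x = "(us, v)"])
qed

text \<open>A list of length \<open>k\<close> spans \<open>q^k\<close> vectors of \<open>S\<close>,
  and any other vector of \<open>S\<close> extends it. For \<open>k\<close> above the dimension of
  \<open>S\<close> both sides are 0, because the factor with \<open>i = vec.dim S\<close>
  vanishes.\<close>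

lemma card_indep_lists:
  fixes S :: "('a::{field,finite} ^ 'n) set"
  assumes "vec.subspace S"
  shows "finite (indep_lists S k) \<and>
    real (card (indep_lists S k)) = (\<Prod>i<k. real CARD('a) ^ vec.dim S - real CARD('a) ^ i)"
proof (induction k)
  case 0
  then show ?case by simp
next
  case (Suc k)
  have diff: "real (card (S - vec.span (set vs))) = real CARD('a) ^ vec.dim S - real CARD('a) ^ k"
    if "vs \<in> indep_lists S k" for vs
  proof -
    have "vec.span (set vs) \<subseteq> S"
      using indep_lists_subset[OF that] assms by (rule vec.span_minimal)
    then show ?thesis
      using card_subspace_diff[OF vec.subspace_span assms] indep_lists_dim[OF that] by simp
  qed
  have inj: "inj_on (\<lambda>(vs, v). v # vs) A" for A :: "(('a ^ 'n) list \<times> ('a ^ 'n)) set"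
    by (auto simp: inj_on_def)
  have "real (card (indep_lists S (Suc k))) =
      (\<Sum>vs\<in>indep_lists S k. real (card (S - vec.span (set vs))))"
    using Suc by (simp add: card_image[OF inj])
  also have "\<dots> = (\<Sum>vs\<in>indep_lists S k. real CARD('a) ^ vec.dim S - real CARD('a) ^ k)"
    using diff by (rule sum.cong[OF refl])
  finally show ?case using Suc by (simp add: mult.commute)
qed

text \<open>Every independent \<open>k\<close>-list of the whole space lies in exactly one
  \<open>k\<close>-dimensional subspace, its span, and all these subspaces contain equally many such
  lists. The count is the quotient of the two numbers of lists.\<close>

lemma card_subspaces:
  assumes "k \<le> CARD('n)"
  shows "real (card {U :: ('a::{field,finite} ^ 'n) set. vec.subspace U \<and> vec.dim U = k}) =
    gauss_binomial CARD('a) CARD('n) k"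
proof -
  let ?X = "{U :: ('a ^ 'n) set. vec.subspace U \<and> vec.dim U = k}"
  let ?q = "real CARD('a)"
  have q: "?q > 1" using card_field_gt_1[where 'a = 'a] by simp
  have un: "indep_lists (UNIV :: ('a ^ 'n) set) k = (\<Union>U\<in>?X. indep_lists U k)"
  proof (intro set_eqI iffI)
    fix vs assume vs: "vs \<in> indep_lists (UNIV :: ('a ^ 'n) set) k"
    then have "vs \<in> indep_lists (vec.span (set vs)) k"
      by (rule indep_lists_mono) (rule vec.span_superset)
    moreover have "vec.span (set vs) \<in> ?X" using indep_lists_dim[OF vs] by simp
    ultimately show "vs \<in> (\<Union>U\<in>?X. indep_lists U k)" by blast
  qed (auto intro: indep_lists_mono)
  have uniq: "U = vec.span (set vs)" if "U \<in> ?X" "vs \<in> indep_lists U k" for U vs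
    using that indep_lists_dim[OF that(2)] indep_lists_subset[OF that(2)]
    by (intro subspace_eq_span) auto
  have "card (indep_lists (UNIV :: ('a ^ 'n) set) k) = (\<Sum>U\<in>?X. card (indep_lists U k))"
    unfolding un
  proof (rule card_UN_disjoint)
    show "\<forall>U\<in>?X. \<forall>V\<in>?X. U \<noteq> V \<longrightarrow> indep_lists U k \<inter> indep_lists V k = {}"
      using uniq by blast
  qed (use card_indep_lists in auto)
  then have "real (card (indep_lists (UNIV :: ('a ^ 'n) set) k)) =
      (\<Sum>U\<in>?X. real (card (indep_lists U k)))" by simp
  also have "\<dots> = (\<Sum>U\<in>?X. \<Prod>i<k. ?q ^ k - ?q ^ i)"
    using card_indep_lists by (intro sum.cong) auto
  finally have main: "(\<Prod>i<k. ?q ^ CARD('n) - ?q ^ i) = real (card ?X) * (\<Prod>i<k. ?q ^ k - ?q ^ i)"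
    using card_indep_lists[of "UNIV :: ('a ^ 'n) set" k, unfolded vec_dim_card] by simp
  \<comment> \<open>Taking \<open>q^i\<close> out of each factor leaves the products of the Gaussian
    binomial. The extracted powers are the same for \<open>m = n\<close> and \<open>m = k\<close>,
    so they cancel.\<close>
  have fac: "(\<Prod>i<k. ?q ^ m - ?q ^ i) = (\<Prod>i<k. ?q ^ i) * (\<Prod>i<k. ?q ^ (m - i) - 1)"
    if "k \<le> m" for m
    unfolding prod.distrib[symmetric] using that
    by (intro prod.cong) (auto simp: algebra_simps simp flip: power_add)
  have "(\<Prod>i<k. ?q ^ i) \<noteq> 0" "(\<Prod>i<k. ?q ^ (k - i) - 1) \<noteq> 0"
    using q one_less_power[OF q] by (auto simp: less_imp_neq[THEN not_sym])
  then show ?thesis using main unfolding gauss_binomial_def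
    by (simp add: fac assms field_simps)
qed

lemma gauss_binomial_nonzero:
  assumes "q > 1" "a \<le> b"
  shows "gauss_binomial q b a \<noteq> 0"
proof -
  have "real q ^ m \<noteq> 1" if "m > 0" for m
    using one_less_power[OF _ that, of "real q"] assms by simp
  then show ?thesis using assms unfolding gauss_binomial_def by auto
qed

section \<open>Cosets of subspaces\<close>

lemma coset_self_mem: "vec.subspace T \<Longrightarrow> y \<in> (+) y ` T"
  using vec.subspace_0 by (auto intro!: image_eqI[where x = 0])

lemma mem_coset_iff: "z \<in> (+) y ` T \<longleftrightarrow> z - y \<in> T"
  for y :: "'a::ab_group_add ^ 'n"
  by (auto intro!: image_eqI[where x = "z - y"])

lemma coset_eq:
  fixes T :: "('a::field ^ 'n) set"
  assumes "vec.subspace T" "z \<in> (+) y ` T"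
  shows "(+) z ` T = (+) y ` T"
proof (intro set_eqI)
  fix x
  have zy: "z - y \<in> T" using assms by (simp add: mem_coset_iff)
  have "x - z \<in> T \<longleftrightarrow> x - y \<in> T"
    using vec.subspace_add[OF assms(1) _ zy, of "x - z"]
      vec.subspace_diff[OF assms(1) _ zy, of "x - y"] by auto
  then show "x \<in> (+) z ` T \<longleftrightarrow> x \<in> (+) y ` T" by (simp add: mem_coset_iff)
qed

text \<open>The cosets of \<open>T\<close> through the points of a coset of \<open>S\<close>
  partition it.\<close>

lemma sum_coset_split:
  fixes S T :: "('a::{field,finite} ^ 'n) set" and w :: "'a ^ 'n \<Rightarrow> real"
  assumes T: "vec.subspace T" and S: "vec.subspace S" and TS: "T \<subseteq> S"
  shows "sum w ((+) p ` S) = (\<Sum>C\<in>(\<lambda>y. (+) y ` T) ` (+) p ` S. sum w C)"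
proof -
  have "(+) p ` S = \<Union> ((\<lambda>y. (+) y ` T) ` (+) p ` S)"
  proof (intro subset_antisym subsetI)
    fix z assume "z \<in> (+) p ` S"
    then show "z \<in> \<Union> ((\<lambda>y. (+) y ` T) ` (+) p ` S)" using coset_self_mem[OF T] by blast
  next
    fix z assume "z \<in> \<Union> ((\<lambda>y. (+) y ` T) ` (+) p ` S)"
    then obtain s t where "s \<in> S" "t \<in> T" "z = p + s + t" by auto
    then show "z \<in> (+) p ` S" using S TS
      by (intro image_eqI[where x = "s + t"]) (auto intro: vec.subspace_add)
  qed
  moreover have "(+) y ` T \<inter> (+) y' ` T = {}" if "(+) y ` T \<noteq> (+) y' ` T" for y y'
    using that coset_eq[OF T] by blast
  moreover have "sum w (\<Union> ((\<lambda>y. (+) y ` T) ` (+) p ` S)) =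
      (sum \<circ> sum) w ((\<lambda>y. (+) y ` T) ` (+) p ` S)"
    using calculation(2) by (intro sum.Union_disjoint) auto
  ultimately show ?thesis by (simp only: o_apply)
qed

section \<open>Subspaces one dimension above a given one\<close>

text \<open>For a subspace \<open>U\<close> of \<open>S\<close> these correspond to the points of
  the projective space of the quotient of \<open>S\<close> by \<open>U\<close>. Translated by
  \<open>p\<close>, they are the flats of the next dimension through a given flat.\<close>

definition extensions :: "('a::field ^ 'n) set \<Rightarrow> ('a ^ 'n) set \<Rightarrow> ('a ^ 'n) set set" where
  "extensions U S = {T. vec.subspace T \<and> U \<subseteq> T \<and> T \<subseteq> S \<and> vec.dim T = vec.dim U + 1}"

text \<open>One vector outside \<open>U\<close> already accounts for the extra dimension. Hence
  different extensions share no vector outside \<open>U\<close>.\<close>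

lemma extension_eq_span:
  assumes "T \<in> extensions U S" "v \<in> T" "v \<notin> U" "vec.subspace U"
  shows "T = vec.span (insert v U)"
proof -
  have "v \<notin> vec.span U" using assms by (metis vec.span_eq_iff)
  then show ?thesis using assms unfolding extensions_def
    by (intro subspace_eq_span) (auto simp: vec.dim_insert)
qed

lemma span_insert_extension:
  assumes "v \<in> S" "v \<notin> U" "vec.subspace U" "vec.subspace S" "U \<subseteq> S"
  shows "vec.span (insert v U) \<in> extensions U S"
proof -
  have "vec.span (insert v U) \<subseteq> S" using assms by (intro vec.span_minimal) auto
  moreover have "vec.dim (vec.span (insert v U)) = vec.dim U + 1"
    unfolding vec.dim_span vec.dim_insert using assms(2,3) by (metis vec.span_eq_iff)
  moreover have "U \<subseteq> vec.span (insert v U)" using vec.span_superset by blast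
  ultimately show ?thesis unfolding extensions_def by auto
qed

text \<open>A vector \<open>v\<close> of \<open>S - U\<close> lies in exactly one extension, the
  span of \<open>insert v U\<close>, so the sets \<open>T - U\<close> partition
  \<open>S - U\<close>. Injectivity allows sums over this partition to be indexed by the extensions
  themselves.\<close>

lemma
  fixes U S :: "('a::field ^ 'n) set"
  assumes "vec.subspace U" "vec.subspace S" "U \<subseteq> S"
  shows Union_extensions_diff: "\<Union> ((\<lambda>T. T - U) ` extensions U S) = S - U"
    and extensions_diff_disjoint: "T \<in> extensions U S \<Longrightarrow> T' \<in> extensions U S \<Longrightarrow>
      T \<noteq> T' \<Longrightarrow> (T - U) \<inter> (T' - U) = {}"
    and inj_on_extensions_diff: "inj_on (\<lambda>T. T - U) (extensions U S)"
proof -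
  show "\<Union> ((\<lambda>T. T - U) ` extensions U S) = S - U"
  proof (intro subset_antisym subsetI)
    fix v assume "v \<in> S - U"
    then have "vec.span (insert v U) \<in> extensions U S" "v \<in> vec.span (insert v U) - U"
      using span_insert_extension[of v S U] assms vec.span_base[of v "insert v U"] by auto
    then show "v \<in> \<Union> ((\<lambda>T. T - U) ` extensions U S)" by blast
  qed (auto simp: extensions_def)
  show "T \<in> extensions U S \<Longrightarrow> T' \<in> extensions U S \<Longrightarrow> T \<noteq> T' \<Longrightarrow> (T - U) \<inter> (T' - U) = {}"
    using extension_eq_span assms(1) by blast
  show "inj_on (\<lambda>T. T - U) (extensions U S)"
    by (rule inj_onI) (auto simp: extensions_def)
qed

lemma sum_diff_extensions:
  fixes U S :: "('a::{field,finite} ^ 'n) set" and w :: "'a ^ 'n \<Rightarrow> 'b::comm_monoid_add"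
  assumes "vec.subspace U" "vec.subspace S" "U \<subseteq> S"
  shows "sum w (S - U) = (\<Sum>T\<in>extensions U S. sum w (T - U))"
proof -
  have "sum w (S - U) = sum w (\<Union> ((\<lambda>T. T - U) ` extensions U S))"
    using Union_extensions_diff[OF assms] by simp
  also have "\<dots> = (sum \<circ> sum) w ((\<lambda>T. T - U) ` extensions U S)"
  proof (rule sum.Union_disjoint)
    show "\<forall>A\<in>(\<lambda>T. T - U) ` extensions U S. \<forall>B\<in>(\<lambda>T. T - U) ` extensions U S.
        A \<noteq> B \<longrightarrow> A \<inter> B = {}"
      using extensions_diff_disjoint[OF assms] by blast
  qed auto
  also have "\<dots> = (\<Sum>T\<in>extensions U S. sum w (T - U))"
    by (simp add: sum.reindex[OF inj_on_extensions_diff[OF assms]])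
  finally show ?thesis .
qed

text \<open>This is the partition of \<open>S - U\<close> with every vector weighted 1. The product
  form avoids a division; the number itself is \<open>(q^d - 1) / (q - 1)\<close>, where
  \<open>d\<close> is the difference of the dimensions.\<close>

lemma card_extensions:
  fixes U S :: "('a::{field,finite} ^ 'n) set"
  assumes "vec.subspace U" "vec.subspace S" "U \<subseteq> S"
  shows "real (card (extensions U S)) *
      (real CARD('a) ^ (vec.dim U + 1) - real CARD('a) ^ vec.dim U) =
    real CARD('a) ^ vec.dim S - real CARD('a) ^ vec.dim U"
proof -
  have "real CARD('a) ^ vec.dim S - real CARD('a) ^ vec.dim U = (\<Sum>v\<in>S - U. 1)"
    using card_subspace_diff[OF assms] by simp
  also have "\<dots> = (\<Sum>T\<in>extensions U S. real (card (T - U)))"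
    by (subst sum_diff_extensions[OF assms]) simp
  also have "\<dots> = (\<Sum>T\<in>extensions U S.
      real CARD('a) ^ (vec.dim U + 1) - real CARD('a) ^ vec.dim U)"
    using card_subspace_diff[OF assms(1)] by (intro sum.cong) (auto simp: extensions_def)
  finally show ?thesis by simp
qed

text \<open>Summing over all extensions counts each point off the flat on \<open>U\<close> once, but
  each point on it once per extension; the correction removes the surplus.\<close>

lemma sum_coset_extensions:
  fixes U S :: "('a::{field,finite} ^ 'n) set" and w :: "'a ^ 'n \<Rightarrow> real"
  assumes "vec.subspace U" "vec.subspace S" "U \<subseteq> S"
  shows "sum w ((+) p ` S) = (\<Sum>T\<in>extensions U S. sum w ((+) p ` T)) -
    (real (card (extensions U S)) - 1) * sum w ((+) p ` U)"
proof -
  let ?f = "\<lambda>v. w (p + v)"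
  have re: "sum w ((+) p ` A) = sum ?f A" for A
    by (simp add: sum.reindex o_def)
  have "sum ?f S - sum ?f U = sum ?f (S - U)"
    using assms by (simp add: sum_diff)
  also have "\<dots> = (\<Sum>T\<in>extensions U S. sum ?f (T - U))"
    by (rule sum_diff_extensions[OF assms])
  also have "\<dots> = (\<Sum>T\<in>extensions U S. sum ?f T - sum ?f U)"
    by (intro sum.cong) (auto simp: sum_diff extensions_def)
  finally show ?thesis unfolding re by (simp add: sum_subtractf algebra_simps)
qed

section \<open>Descent of weights in {0, 1} by one dimension\<close>

text \<open>
  Let \<open>P\<close> be a \<open>j\<close>-flat, \<open>t = q * w(P)\<close> and \<open>M = (q^m - 1) / (q - 1)\<close>. Counting the
  \<open>(j+1)\<close>-flats of weight 1 through \<open>P\<close> gives \<open>x + M * t\<close>; the same count inside a \<open>(j+2)\<close>-flat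
  shows that \<open>t\<close> is an integer. Hence \<open>x < M\<close> forces \<open>t \<ge> 0\<close>. If \<open>t > 0\<close>, then every \<open>(j+1)\<close>-flat
  through \<open>P\<close> has positive weight, so weight 1, and \<open>1 + q * M = x + M * t\<close> yields \<open>t \<ge> q\<close>.
\<close>
lemma boolean_descent:
  fixes w :: "'a::{field,finite} ^ 'n \<Rightarrow> real"
  assumes bool: "\<And>p T. vec.subspace T \<Longrightarrow> vec.dim T = Suc j \<Longrightarrow> sum w ((+) p ` T) \<in> {0, 1}"
    and n: "CARD('n) = j + 1 + m" and m: "m > 0"
    and less: "sum w UNIV * (real CARD('a) - 1) < real CARD('a) ^ m - 1"
    and U: "vec.subspace U" "vec.dim U = j"
  shows "sum w ((+) p ` U) \<in> {0, 1}"
proof -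
  define q where "q = real CARD('a)"
  define M where "M = (q ^ m - 1) / (q - 1)"
  define t where "t y = q * sum w ((+) y ` U)" for y
  define r where "r y = (\<Sum>T\<in>extensions U UNIV. sum w ((+) y ` T))" for y
  have q: "q > 1" using card_field_gt_1[where 'a = 'a] by (simp add: q_def)
  have M: "M > 0" using one_less_power[OF q m] q by (simp add: M_def)
  have xM: "sum w UNIV < M" using less q by (simp add: M_def q_def[symmetric] field_simps)
  have ext: "sum w ((+) y ` T) \<in> {0, 1}" if "T \<in> extensions U S" for y S T
    using that bool U by (auto simp: extensions_def)
  have dimU: "vec.dim (UNIV :: ('a ^ 'n) set) = j + 1 + m"
    using n by (simp only: vec_dim_card)
  have "real (card (extensions U UNIV)) * (q ^ (j + 1) - q ^ j) = q ^ (j + 1 + m) - q ^ j"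
    using card_extensions[OF U(1) vec.subspace_UNIV subset_UNIV, unfolded dimU] U(2)
    by (simp add: q_def)
  then have "q ^ j * (real (card (extensions U UNIV)) * (q - 1)) = q ^ j * (q * q ^ m - 1)"
    by (simp add: algebra_simps power_add)
  then have "real (card (extensions U UNIV)) * (q - 1) = q * q ^ m - 1"
    using q by simp
  \<comment> \<open>In the form \<open>1 + q * M\<close> the surplus number of extensions is
    \<open>q * M\<close>, and its factor \<open>q\<close> is absorbed into \<open>t\<close>.\<close>
  then have c: "real (card (extensions U UNIV)) = 1 + q * M"
    using q by (simp add: M_def field_simps)
  have x: "sum w UNIV = r y - M * t y" for y
    using sum_coset_extensions[OF U(1) vec.subspace_UNIV subset_UNIV, of w y] c
    by (simp add: r_def t_def surj_plus)
  have r0: "r y \<ge> 0" for y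
  proof -
    have "sum w ((+) y ` T) \<ge> 0" if "T \<in> extensions U UNIV" for T
      using ext[OF that, of y] by auto
    then show ?thesis unfolding r_def by (rule sum_nonneg)
  qed
  have t_int: "t y \<in> \<int>" for y
  proof -
    have "vec.dim U < vec.dim (UNIV :: ('a ^ 'n) set)" using dimU U by simp
    then obtain v where v: "v \<notin> U" by (metis UNIV_eq_I less_irrefl)
    define T where "T = vec.span (insert v U)"
    have T: "T \<in> extensions U UNIV"
      unfolding T_def using U v by (intro span_insert_extension) auto
    then have T': "vec.subspace T" "vec.dim T = j + 1" "U \<subseteq> T"
      using U by (auto simp: extensions_def)
    \<comment> \<open>Since \<open>m > 0\<close>, there is room for a second extension, which yields
      a chain of dimensions \<open>j\<close>, \<open>j + 1\<close>, \<open>j + 2\<close>.\<close>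
    have "vec.dim T < vec.dim (UNIV :: ('a ^ 'n) set)" using dimU T' m by simp
    then obtain v' where v': "v' \<notin> T" by (metis UNIV_eq_I less_irrefl)
    define S where "S = vec.span (insert v' T)"
    have "S \<in> extensions T UNIV"
      unfolding S_def using T' v' by (intro span_insert_extension) auto
    then have S: "vec.subspace S" "vec.dim S = j + 2" "T \<subseteq> S" "U \<subseteq> S"
      using T' by (auto simp: extensions_def)
    have "real (card (extensions U S)) * (q ^ (j + 1) - q ^ j) = q ^ (j + 2) - q ^ j"
      using card_extensions[OF U(1) S(1,4)] U(2) S(2) by (simp add: q_def)
    then have "q ^ j * (q - 1) * real (card (extensions U S)) = q ^ j * (q - 1) * (q + 1)"
      by (simp add: algebra_simps power_add power2_eq_square)
    then have cS: "real (card (extensions U S)) = q + 1" using q by simp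
    \<comment> \<open>With \<open>q + 1\<close> extensions inside \<open>S\<close> the surplus is
      exactly \<open>t y\<close>, which thus becomes a difference of two integers.\<close>
    have "sum w ((+) y ` S) = (\<Sum>T\<in>extensions U S. sum w ((+) y ` T)) - t y"
      using sum_coset_extensions[OF U(1) S(1,4), of w y] cS by (simp add: t_def)
    \<comment> \<open>The flat on \<open>S\<close> is cut into cosets of \<open>T\<close>, each of
      weight 0 or 1, so its weight is an integer.\<close>
    moreover have "sum w ((+) z ` T) \<in> \<int>" for z
      using bool[OF T'(1), of z] T'(2) by auto
    then have "sum w ((+) y ` S) \<in> \<int>"
      unfolding sum_coset_split[OF T'(1) S(1,3)] by (auto intro: Ints_sum[of _ "sum w"])
    moreover have "sum w ((+) y ` T) \<in> \<int>" if "T \<in> extensions U S" for T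
      using ext[OF that, of y] by auto
    then have "(\<Sum>T\<in>extensions U S. sum w ((+) y ` T)) \<in> \<int>" by (rule Ints_sum)
    ultimately show ?thesis by (metis Ints_diff diff_diff_eq2 add_diff_cancel_left')
  qed
  have t0: "t y \<ge> 0" for y
  proof (rule ccontr)
    assume "\<not> t y \<ge> 0"
    moreover obtain i where "t y = of_int i" using t_int Ints_cases by blast
    ultimately have "t y \<le> -1" by simp
    then have "M * t y \<le> - M" using M mult_left_mono[of "t y" "-1" M] by simp
    then show False using x[of y] r0[of y] xM by linarith
  qed
  have w0: "sum w ((+) y ` U) \<ge> 0" for y
    using t0[of y] q by (simp add: t_def zero_le_mult_iff)
  \<comment> \<open>The flat on \<open>T\<close> is cut into cosets of \<open>U\<close>. All of them
    have nonnegative weight, which is why \<open>t0\<close> and \<open>w0\<close> are proved for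
    every \<open>y\<close>.\<close>
  have mono: "sum w ((+) p ` U) \<le> sum w ((+) p ` T)" if "T \<in> extensions U UNIV" for T
  proof -
    have T: "vec.subspace T" "U \<subseteq> T" using that by (auto simp: extensions_def)
    show ?thesis unfolding sum_coset_split[OF U(1) T]
      using w0 coset_self_mem[OF T(1)] by (intro member_le_sum) auto
  qed
  show ?thesis
  proof (cases "sum w ((+) p ` U) = 0")
    case False
    then have pos: "sum w ((+) p ` U) > 0" using w0[of p] by simp
    have one: "sum w ((+) p ` T) = 1" if "T \<in> extensions U UNIV" for T
      using mono[OF that] ext[OF that, of p] pos by auto
    then have "r p = 1 + q * M" using c by (simp add: r_def)
    \<comment> \<open>Substituting for \<open>r p\<close> gives \<open>(q - t p) * M = x - 1\<close>
      with \<open>x = sum w UNIV < M\<close>.\<close>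
    then have "(q - t p) * M < 1 * M" using x[of p] xM by (simp add: algebra_simps)
    then have "q - t p < 1" using M by (simp only: mult_less_cancel_right_pos)
    moreover obtain i where "q - t p = of_int i"
      using t_int[of p] by (metis Ints_cases Ints_diff Ints_of_nat q_def)
    ultimately have "t p \<ge> q" by simp
    then have "sum w ((+) p ` U) \<ge> 1" using q by (simp add: t_def)
    \<comment> \<open>The upper bound needs an actual flat of weight 1 through the given
      one.\<close>
    moreover have "extensions U UNIV \<noteq> {}"
    proof
      assume "extensions U UNIV = {}"
      then have "1 + q * M = 0" using c by simp
      moreover have "q * M > 0" using q M by simp
      ultimately show False by linarith
    qed
    ultimately show ?thesis using mono one by force
  qed simp
qed

section \<open>From the row space to point weights\<close>

text \<open>The coefficients of a combination of rows are point weights, and its entry at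
  \<open>K\<close> is the weight of \<open>K\<close>. Instead of extracting coefficients, the proof
  observes that the vectors arising from weights form a subspace containing all rows.\<close>

lemma cameron_liebler_weights:
  fixes L :: "('a::{field,finite} ^ 'n) set set"
  assumes "cameron_liebler k L"
  shows "\<exists>w :: 'a ^ 'n \<Rightarrow> real. \<forall>K\<in>k_spaces k. sum w K = (if K \<in> L then 1 else 0)"
proof -
  let ?R = "range (\<lambda>w :: 'a ^ 'n \<Rightarrow> real.
    (\<chi> K. if K \<in> k_spaces k then sum w K else 0) :: real ^ (('a ^ 'n) set))"
  have "subspace ?R"
    unfolding subspace_def
  proof (intro conjI ballI allI)
    show "0 \<in> ?R"
      by (rule image_eqI[where x = "\<lambda>_. 0"]) (auto simp: vec_eq_iff)
    fix x y assume "x \<in> ?R" "y \<in> ?R"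
    then obtain u v where "x = (\<chi> K. if K \<in> k_spaces k then sum u K else 0)"
      "y = (\<chi> K. if K \<in> k_spaces k then sum v K else 0)" by blast
    then show "x + y \<in> ?R"
      by (intro image_eqI[where x = "\<lambda>p. u p + v p"]) (auto simp: vec_eq_iff sum.distrib)
  next
    fix c x assume "x \<in> ?R"
    then obtain u where "x = (\<chi> K. if K \<in> k_spaces k then sum u K else 0)" by blast
    then show "c *\<^sub>R x \<in> ?R"
      by (intro image_eqI[where x = "\<lambda>p. c * u p"]) (auto simp: vec_eq_iff sum_distrib_left)
  qed
  moreover have "rows (incidence_matrix k) \<subseteq> ?R"
  proof
    fix v assume "v \<in> rows (incidence_matrix k :: real ^ (('a ^ 'n) set) ^ ('a ^ 'n))"
    then obtain p where "v = row p (incidence_matrix k)" by (auto simp: rows_def)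
    then show "v \<in> ?R"
      \<comment> \<open>The row of \<open>p\<close> arises from the unit weight at
        \<open>p\<close>.\<close>
      by (intro image_eqI[where x = "\<lambda>y. if y = p then 1 else 0"])
        (auto simp: row_def incidence_matrix_def fun_eq_iff cong: if_cong)
  qed
  ultimately have "char_vec L \<in> ?R"
    using assms span_minimal unfolding cameron_liebler_def by blast
  then obtain w where w: "char_vec L = (\<chi> K. if K \<in> k_spaces k then sum w K else 0)" by blast
  show ?thesis
  proof (intro exI ballI)
    fix K :: "('a ^ 'n) set" assume "K \<in> k_spaces k"
    then show "sum w K = (if K \<in> L then 1 else 0)"
      using arg_cong[OF w, of "\<lambda>v. v $ K"] by (simp add: char_vec_def)
  qed
qed

text \<open>Translation by \<open>p\<close> is a bijection from the \<open>k\<close>-dimensional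
  subspaces to the \<open>k\<close>-spaces through \<open>p\<close>.\<close>

lemma card_point_pencil:
  fixes p :: "'a::{field,finite} ^ 'n"
  assumes "k \<le> CARD('n)"
  shows "real (card (point_pencil k p)) = gauss_binomial CARD('a) CARD('n) k"
proof -
  let ?X = "{U :: ('a ^ 'n) set. vec.subspace U \<and> vec.dim U = k}"
  have "point_pencil k p = (\<lambda>U. (+) p ` U) ` ?X"
  proof (intro set_eqI iffI)
    fix K assume "K \<in> point_pencil k p"
    then obtain y U where "U \<in> ?X" "K = (+) y ` U" "p \<in> (+) y ` U"
      unfolding point_pencil_def k_spaces_def by blast
    moreover from this have "(+) p ` U = (+) y ` U" by (intro coset_eq) auto
    ultimately show "K \<in> (\<lambda>U. (+) p ` U) ` ?X" by blast
  next
    fix K assume "K \<in> (\<lambda>U. (+) p ` U) ` ?X"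
    then show "K \<in> point_pencil k p"
      unfolding point_pencil_def k_spaces_def using coset_self_mem by blast
  qed
  moreover have "inj_on (\<lambda>U. (+) p ` U) ?X"
    by (rule inj_onI) (simp add: inj_image_eq_iff)
  ultimately show ?thesis using card_subspaces[OF assms] by (simp add: card_image)
qed

text \<open>Count incident pairs of a point and a \<open>k\<close>-space, weighted by
  \<open>w\<close>. Every point lies on the same number of \<open>k\<close>-spaces, and this number
  is the normalising factor in \<open>has_parameter\<close>.\<close>

lemma parameter_eq_weight:
  fixes L :: "('a::{field,finite} ^ 'n) set set"
  assumes "L \<subseteq> k_spaces k" "has_parameter k L x" "k \<le> CARD('n)"
    and w: "\<And>K. K \<in> k_spaces k \<Longrightarrow> sum w K = (if K \<in> L then 1 else 0)"
  shows "x = sum w UNIV"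
proof -
  let ?g = "gauss_binomial CARD('a) CARD('n) k"
  have "real (card L) = (\<Sum>K\<in>k_spaces k. if K \<in> L then 1 else 0)"
    using assms(1) by (simp add: sum.If_cases Int_absorb1)
  also have "\<dots> = (\<Sum>K\<in>k_spaces k. sum w K)" using w by simp
  also have "\<dots> = (\<Sum>K\<in>k_spaces k. \<Sum>p\<in>{p\<in>UNIV. p \<in> K}. w p)" by simp
  also have "\<dots> = (\<Sum>p\<in>UNIV. \<Sum>K\<in>{K\<in>k_spaces k. p \<in> K}. w p)"
    by (rule sum.swap_restrict) auto
  also have "\<dots> = (\<Sum>p\<in>UNIV. real (card (point_pencil k p)) * w p)"
    by (simp add: point_pencil_def)
  also have "\<dots> = sum w UNIV * ?g"
    by (simp add: card_point_pencil[OF assms(3)] sum_distrib_left[symmetric])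
  finally have "sum w UNIV * ?g = x * ?g" using assms(2) by (simp add: has_parameter_def)
  then show ?thesis
    using gauss_binomial_nonzero[OF card_field_gt_1[where 'a = 'a] assms(3)] by simp
qed

section \<open>Descent to points\<close>

lemma small_weight_boolean:
  fixes w :: "'a::{field,finite} ^ 'n \<Rightarrow> real"
  assumes bool: "\<And>p T. vec.subspace T \<Longrightarrow> vec.dim T = k \<Longrightarrow> sum w ((+) p ` T) \<in> {0, 1}"
    and k: "k < CARD('n)"
    and less: "sum w UNIV * (real CARD('a) - 1) < real CARD('a) ^ (CARD('n) - k) - 1"
    and U: "vec.subspace U" "vec.dim U \<le> k"
  shows "sum w ((+) p ` U) \<in> {0, 1}"
proof -
  have q: "real CARD('a) > 1" using card_field_gt_1[where 'a = 'a] by simp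
  have "\<forall>p U. vec.subspace U \<longrightarrow> vec.dim U = j \<longrightarrow> sum w ((+) p ` U) \<in> {0, 1}" if "j \<le> k" for j
    using that
  proof (induction j rule: inc_induct)
    case base
    then show ?case using bool by blast
  next
    case (step j)
    \<comment> \<open>The descent from \<open>j + 1\<close> to \<open>j\<close> uses
      \<open>m = n - j - 1\<close>. This is at least \<open>n - k\<close> because
      \<open>j < k\<close>, so the bound on the total weight only gets weaker on the way
      down.\<close>
    have "real CARD('a) ^ (CARD('n) - k) \<le> real CARD('a) ^ (CARD('n) - j - 1)"
      using q step.hyps by (intro power_increasing) auto
    then have l: "sum w UNIV * (real CARD('a) - 1) < real CARD('a) ^ (CARD('n) - j - 1) - 1"
      using less by simp
    have n: "CARD('n) = j + 1 + (CARD('n) - j - 1)" "CARD('n) - j - 1 > 0"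
      using step.hyps k by auto
    show ?case
    proof (intro allI impI)
      fix p :: "'a ^ 'n" and U :: "('a ^ 'n) set"
      assume "vec.subspace U" "vec.dim U = j"
      then show "sum w ((+) p ` U) \<in> {0, 1}"
        using step.IH by (metis boolean_descent[OF _ n l])
    qed
  qed
  then show ?thesis using U by blast
qed

section \<open>The lower bound on the parameter\<close>

theorem theorem6p5:
  fixes L :: "('a::{field,finite} ^ 'n) set set"
    and n q k :: nat
    and x :: real
  assumes "q = CARD('a)"
    and "n = CARD('n)"
    and "n \<ge> 2 * k + 2"
    and "k \<ge> 1"
    and "cameron_liebler k L"
    and "has_parameter k L x"
    and "\<nexists>p. L = point_pencil k p"
    and "L \<noteq> {}"
  shows "x \<ge> 2 * ((real q ^ (n - k) - 1) / (real q ^ (k + 1) - 1)) + 1"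
proof (rule ccontr)
  assume neg: "\<not> ?thesis"
  have q: "real q > 1" using card_field_gt_1[where 'a = 'a] assms(1) by simp
  have L: "L \<subseteq> k_spaces k" using assms(5) by (simp add: cameron_liebler_def)
  obtain w :: "'a ^ 'n \<Rightarrow> real"
    where w: "\<And>K. K \<in> k_spaces k \<Longrightarrow> sum w K = (if K \<in> L then 1 else 0)"
    using cameron_liebler_weights[OF assms(5)] by metis
  have k: "k < CARD('n)" using assms(2,3) by simp
  have x: "x = sum w UNIV"
    by (rule parameter_eq_weight[OF L assms(6) less_imp_le[OF k] w])
  \<comment> \<open>The negated bound is weakened to \<open>x * (q - 1) < A\<close>, the hypothesis
    of the descent. The estimates use \<open>n - k \<ge> 3\<close> and \<open>k + 1 \<ge> 2\<close>,
    which follow from \<open>n \<ge> 2 * k + 2\<close> and \<open>k \<ge> 1\<close>.\<close>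
  define A where "A = real q ^ (n - k) - 1"
  have "real q ^ 3 \<le> real q ^ (n - k)" using q assms by (intro power_increasing) auto
  moreover have "real q \<ge> 2" using q by simp
  then have "2 * 2 * real q \<le> real q * real q * real q" by (intro mult_mono) auto
  ultimately have A: "A \<ge> real q + 1"
    using \<open>real q \<ge> 2\<close> unfolding A_def power3_eq_cube by linarith
  have "real q ^ 2 \<le> real q ^ (k + 1)" using q assms by (intro power_increasing) auto
  then have B: "(real q - 1) * (real q + 1) \<le> real q ^ (k + 1) - 1"
    by (simp add: algebra_simps power2_eq_square)
  have "x < 2 * (A / (real q ^ (k + 1) - 1)) + 1" using neg by (simp add: A_def)
  also have "\<dots> \<le> 2 * (A / ((real q - 1) * (real q + 1))) + 1"
    using A q frac_le[OF _ order_refl _ B, of A] by simp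
  finally have "x * (real q - 1) < (2 * (A / ((real q - 1) * (real q + 1))) + 1) * (real q - 1)"
    using q by simp
  also have "\<dots> = 2 * A / (real q + 1) + (real q - 1)"
  proof -
    have "A / ((real q - 1) * (real q + 1)) * (real q - 1) = A / (real q + 1)" using q by simp
    then show ?thesis by (simp only: distrib_right mult.assoc times_divide_eq_right mult_1_left)
  qed
  also have "\<dots> \<le> A"
  proof -
    \<comment> \<open>After cancellation this is \<open>(q - 1) * (q + 1) \<le> A * (q - 1)\<close>,
      which is the estimate \<open>A \<ge> q + 1\<close> multiplied by \<open>q - 1\<close>.\<close>
    have "2 * A + (real q - 1) * (real q + 1) \<le> A * (real q + 1)"
      using mult_right_mono[OF A, of "real q - 1"] q by (simp add: algebra_simps)
    then show ?thesis using q by (simp add: field_simps)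
  qed
  finally have less: "sum w UNIV * (real CARD('a) - 1) < real CARD('a) ^ (CARD('n) - k) - 1"
    using assms(1,2) x by (simp add: A_def)
  have "sum w ((+) p ` T) \<in> {0, 1}" if "vec.subspace T" "vec.dim T = k" for p T
  proof -
    have "(+) p ` T \<in> k_spaces k" unfolding k_spaces_def using that by blast
    then show ?thesis using w by simp
  qed
  then have bool: "sum w ((+) p ` U) \<in> {0, 1}" if "vec.subspace U" "vec.dim U \<le> k" for p U
    using small_weight_boolean[OF _ k less that] by blast
  \<comment> \<open>Points are the cosets of the zero subspace.\<close>
  have w01: "w p \<in> {0, 1}" for p
    using bool[of "{0}" p] by simp
  have uniq: "p = p'" if "w p = 1" "w p' = 1" for p p'
  proof (rule ccontr)
    assume "p \<noteq> p'"
    \<comment> \<open>The line joining the two points has dimension at most \<open>k\<close> since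
      \<open>k \<ge> 1\<close>, so its weight is at most 1. As no point has negative weight, it
      would also be at least 2.\<close>
    define U where "U = vec.span {p' - p}"
    have mem: "p \<in> (+) p ` U" "p' \<in> (+) p ` U"
      unfolding mem_coset_iff U_def by (auto simp: vec.span_base vec.span_zero)
    have "vec.dim U \<le> k" using assms(4) by (simp add: U_def vec.dim_insert)
    then have "sum w ((+) p ` U) \<in> {0, 1}" by (intro bool) (simp_all add: U_def)
    moreover have "sum w {p, p'} \<le> sum w ((+) p ` U)"
      using mem w01 by (intro sum_mono2) (auto, metis insert_iff order_refl singletonD zero_le_one)
    ultimately show False using that \<open>p \<noteq> p'\<close> by auto
  qed
  obtain K where K: "K \<in> L" using assms(8) by blast
  then have "sum w K \<noteq> 0" using w[of K] L by auto
  then obtain p where "p \<in> K" "w p \<noteq> 0" by (meson sum.neutral)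
  then have p: "w p = 1" using w01[of p] by simp
  \<comment> \<open>The weight is now the indicator of \<open>p\<close>, so a \<open>k\<close>-space
    has weight 1 exactly when it contains \<open>p\<close>.\<close>
  have wd: "w y = (if y = p then 1 else 0)" for y
    using p uniq w01[of y] by auto
  have "K \<in> L \<longleftrightarrow> K \<in> point_pencil k p" for K
  proof (cases "K \<in> k_spaces k")
    case True
    have "sum w K = (if p \<in> K then 1 else 0)" by (simp add: wd)
    then show ?thesis using w[OF True] True by (simp add: point_pencil_def split: if_splits)
  qed (use L in \<open>auto simp: point_pencil_def\<close>)
  then show False using assms(7) by blast
qed

end
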